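(* Let $X$ be a locally convex space and $\mathcal{S}\subset\mathscr{L}(X)$ a left amenable semigroup with relatively compact convex orbits $\mathrm{co}\,\mathcal{S}x$ for all $x\in X$. The following are equivalent. (i) The semigroup $\mathcal{S}$ is left mean ergodic. (ii) The semigroup $\mathcal{K}(\mathrm{co}\,\mathcal{S})$ has a zero $Q$, i.e. $QS=SQ=Q$ for every $S\in\mathcal{K}(\mathrm{co}\,\mathcal{S})$. If these assertions hold, then $\lim_\alpha T_\alpha x=Qx$ for all $x\in X$ and each left ergodic net $(T_\alpha)_{\alpha\in A}$ for $\mathcal{S}$.
   Context: All vector spaces are complex; topological vector spaces are Hausdorff. $\mathscr{L}(X)$ is the set of continuous linear maps on $X$; $\mathrm{co}$ denotes convex hull. $\mathcal{K}(\mathrm{co}\,\mathcal{S})$ is the closure of $\mathrm{co}\,\mathcal{S}$ in $X^X$ with the product topology (pointwise convergence), a semigroup under composition. A net $(T_\alpha)_{\alpha\in A}\subset\overline{\mathrm{co}\,\mathcal{S}}^{X^X}$ is a left ergodic net for $\mathcal{S}$ if $\lim_\alpha(\mathrm{Id}-T)T_\alpha x=0$ for each $x\in X$ and $T\in\mathcal{S}$. $\mathcal{S}$ is left mean ergodic if each left ergodic net for $\mathcal{S}$ is pointwise convergent on $X$. A semitopological semigroup $S$ (separately continuous multiplication) is left amenable if the space $\mathrm{C}_{\mathrm{b}}(S)$ of bounded continuous functions has a left invariant mean, i.e. a positive $m\in\mathrm{C}_{\mathrm{b}}(S)'$ with $m(\mathbf{1})=1$ and $m(L_sf)=m(f)$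 for all $f\in\mathrm{C}_{\mathrm{b}}(S)$, $s\in S$, where $L_sf(t)=f(st)$. Left amenability of $\mathcal{S}\subset\mathscr{L}(X)$ refers to $\mathcal{S}$ endowed with the topology of pointwise convergence. *)

theory Defs
  imports "HOL-Analysis.Analysis" "HOL-Library.Function_Algebras"
begin

section \<open>Complex locally convex spaces\<close>

class scaleC =
  fixes scaleC :: "complex \<Rightarrow> 'a \<Rightarrow> 'a" (infixr \<open>*\<^sub>C\<close> 75)

class complex_vector = real_vector + scaleC +
  assumes scaleC_add_right: "c *\<^sub>C (x + y) = c *\<^sub>C x + c *\<^sub>C y"
    and scaleC_add_left: "(c + d) *\<^sub>C x = c *\<^sub>C x + d *\<^sub>C x"
    and scaleC_scaleC: "c *\<^sub>C d *\<^sub>C x = (c * d) *\<^sub>C x"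
    and scaleC_one: "1 *\<^sub>C x = x"
    and scaleR_eq_scaleC: "r *\<^sub>R x = complex_of_real r *\<^sub>C x"

text \<open>The class mechanism does not accept \<open>continuous_on\<close> and \<open>convex\<close> here, so joint continuity
  of the scalar multiplication and convexity are unfolded; the two lemmas below restate them.\<close>

class complex_lcs = complex_vector + topological_ab_group_add + t2_space +
  assumes tendsto_scaleC_Pair:
      "((\<lambda>p. fst p *\<^sub>C snd p) \<longlongrightarrow> c *\<^sub>C x) (nhds c \<times>\<^sub>F nhds x)"
    and locally_convex_unfolded:
      "open U \<Longrightarrow> 0 \<in> U \<Longrightarrow> \<exists>V. open V \<and> 0 \<in> V \<and> V \<subseteq> U \<and>
        (\<forall>x\<in>V. \<forall>y\<in>V. \<forall>u\<ge>0. \<forall>v\<ge>0. u + v = 1 \<longrightarrow> u *\<^sub>R x + v *\<^sub>R y \<in> V)"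

lemma continuous_scaleC:
  "continuous_on UNIV (\<lambda>(c, x::'a::complex_lcs). c *\<^sub>C x)"
proof -
  have "((\<lambda>p. fst p *\<^sub>C snd p) \<longlongrightarrow> fst q *\<^sub>C snd q) (at q)" for q :: "complex \<times> 'a"
    using tendsto_scaleC_Pair[of "fst q" "snd q"]
    by (intro tendsto_mono[of "at q" "nhds q"]) (auto simp: nhds_prod[symmetric] at_within_def)
  then show ?thesis
    by (simp add: continuous_on_def case_prod_beta)
qed

lemma locally_convex:
  fixes U :: "'a::complex_lcs set"
  assumes "open U" "0 \<in> U"
  shows "\<exists>V. open V \<and> convex V \<and> 0 \<in> V \<and> V \<subseteq> U"
  using locally_convex_unfolded[OF assms] by (auto simp: convex_def)

definition continuous_operators :: "('a::complex_lcs \<Rightarrow> 'a) set" where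
  "continuous_operators =
     {T. Vector_Spaces.linear scaleC scaleC T \<and> continuous_on UNIV T}"

definition operator_semigroup :: "('a::complex_lcs \<Rightarrow> 'a) set \<Rightarrow> bool" where
  "operator_semigroup S \<longleftrightarrow>
     S \<noteq> {} \<and> S \<subseteq> continuous_operators \<and> (\<forall>T\<in>S. \<forall>R\<in>S. T \<circ> R \<in> S)"

text \<open>The pointwise real vector space structure on functions; it makes \<open>convex hull\<close>
  available for sets of maps.\<close>

instantiation "fun" :: (type, real_vector) real_vector
begin

definition scaleR_fun :: "real \<Rightarrow> ('a \<Rightarrow> 'b) \<Rightarrow> 'a \<Rightarrow> 'b" where
  "scaleR_fun r f = (\<lambda>x. r *\<^sub>R f x)"

instance
  by standard (simp_all add: scaleR_fun_def fun_eq_iff scaleR_add_right scaleR_add_left)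

end

text \<open>The topology of \<^typ>\<open>'a \<Rightarrow> 'a\<close> is the product topology, i.e. that of pointwise
  convergence, so \<open>closure\<close> is the closure in \<open>X\<^sup>X\<close>.\<close>

definition K_co :: "('a::complex_lcs \<Rightarrow> 'a) set \<Rightarrow> ('a \<Rightarrow> 'a) set" where
  "K_co S = closure (convex hull S)"

definition semigroup_zero :: "('a \<Rightarrow> 'a) set \<Rightarrow> ('a \<Rightarrow> 'a) \<Rightarrow> bool" where
  "semigroup_zero K Q \<longleftrightarrow> Q \<in> K \<and> (\<forall>R\<in>K. Q \<circ> R = Q \<and> R \<circ> Q = Q)"


section \<open>Left amenability\<close>

text \<open>A semigroup is given by a topology on its carrier and a multiplication. Elements of
  \<open>C\<^sub>b\<close> are represented by functions on the whole type; their values outside the carrier are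
  irrelevant, and the boundedness condition in \<open>left_invariant_mean\<close> forces the mean to
  ignore them. That condition is continuity for the supremum norm over the carrier, and the
  scalars are complex.\<close>

definition Cb :: "'s topology \<Rightarrow> ('s \<Rightarrow> complex) set" where
  "Cb X = {f. continuous_map X euclidean f \<and> bounded (f ` topspace X)}"

definition left_invariant_mean ::
  "'s topology \<Rightarrow> ('s \<Rightarrow> 's \<Rightarrow> 's) \<Rightarrow> (('s \<Rightarrow> complex) \<Rightarrow> complex) \<Rightarrow> bool" where
  "left_invariant_mean X mul m \<longleftrightarrow>
     (\<forall>f\<in>Cb X. \<forall>g\<in>Cb X. m (\<lambda>t. f t + g t) = m f + m g) \<and>
     (\<forall>c. \<forall>f\<in>Cb X. m (\<lambda>t. c * f t) = c * m f) \<and>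
     (\<exists>B. \<forall>f\<in>Cb X. \<forall>M. (\<forall>t\<in>topspace X. norm (f t) \<le> M) \<longrightarrow> norm (m f) \<le> B * M) \<and>
     (\<forall>f\<in>Cb X. (\<forall>t\<in>topspace X. f t \<in> \<real>\<^sub>\<ge>\<^sub>0) \<longrightarrow> m f \<in> \<real>\<^sub>\<ge>\<^sub>0) \<and>
     m (\<lambda>t. 1) = 1 \<and>
     (\<forall>f\<in>Cb X. \<forall>s\<in>topspace X. m (\<lambda>t. f (mul s t)) = m f)"

definition left_amenable :: "'s topology \<Rightarrow> ('s \<Rightarrow> 's \<Rightarrow> 's) \<Rightarrow> bool" where
  "left_amenable X mul \<longleftrightarrow> (\<exists>m. left_invariant_mean X mul m)"


section \<open>Nets\<close>

text \<open>An index set \<open>A\<close> is directed by a relation \<open>r\<close>, where \<open>(a, b) \<in> r\<close> means \<open>a \<le> b\<close>.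
  \<open>net_filter A r\<close> is the filter generated by the tails; limits along it are limits of
  nets indexed by \<open>A\<close>.\<close>

definition directed_set :: "'i set \<Rightarrow> 'i rel \<Rightarrow> bool" where
  "directed_set A r \<longleftrightarrow>
     A \<noteq> {} \<and> preorder_on A r \<and> (\<forall>a\<in>A. \<forall>b\<in>A. \<exists>c\<in>A. (a, c) \<in> r \<and> (b, c) \<in> r)"

definition net_filter :: "'i set \<Rightarrow> 'i rel \<Rightarrow> 'i filter" where
  "net_filter A r = (INF a\<in>A. principal {b. (a, b) \<in> r})"

lemma eventually_net_filter:
  assumes "directed_set A r"
  shows "eventually P (net_filter A r) \<longleftrightarrow> (\<exists>a\<in>A. \<forall>b. (a, b) \<in> r \<longrightarrow> P b)"
proof -
  have tr: "trans r"
    using assms by (auto simp: directed_set_def preorder_on_def)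
  have "eventually P (net_filter A r) \<longleftrightarrow>
      (\<exists>a\<in>A. eventually P (principal {b. (a, b) \<in> r}))"
    unfolding net_filter_def
  proof (rule eventually_INF_base)
    show "A \<noteq> {}" using assms by (simp add: directed_set_def)
    fix a b assume "a \<in> A" "b \<in> A"
    then obtain c where "c \<in> A" "(a, c) \<in> r" "(b, c) \<in> r"
      using assms by (auto simp: directed_set_def)
    with tr show "\<exists>x\<in>A. principal {b. (x, b) \<in> r}
        \<le> inf (principal {b. (a, b) \<in> r}) (principal {ba. (b, ba) \<in> r})"
      by (intro bexI[of _ c]) (auto dest: transD)
  qed
  then show ?thesis by (simp add: eventually_principal)
qed

definition left_ergodic_net ::
  "('a::complex_lcs \<Rightarrow> 'a) set \<Rightarrow> 'i set \<Rightarrow> 'i rel \<Rightarrow> ('i \<Rightarrow> 'a \<Rightarrow> 'a) \<Rightarrow> bool" where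
  "left_ergodic_net S A r T \<longleftrightarrow>
     directed_set A r \<and> T ` A \<subseteq> K_co S \<and>
     (\<forall>x. \<forall>R\<in>S. ((\<lambda>\<alpha>. T \<alpha> x - R (T \<alpha> x)) \<longlongrightarrow> 0) (net_filter A r))"

text \<open>HOL cannot quantify over all index types inside a formula. Nothing is lost by indexing
  nets of maps by pairs of a map and a set of maps: every net has the same image of its tail
  filter, hence the same limits, as one with such indices and the same values.\<close>

lemma canonical_reindexing:
  fixes T :: "'i \<Rightarrow> 'x"
  assumes dir: "directed_set A r"
  shows "\<exists>(A' :: ('x \<times> 'x set) set) r' T'.
    directed_set A' r' \<and> T' ` A' \<subseteq> T ` A \<and>
    filtermap T' (net_filter A' r') = filtermap T (net_filter A r)"
proof -
  define tl where "tl a = T ` {b. (a, b) \<in> r}" for a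
  define A' where "A' = {(y, tl a) | y a. a \<in> A \<and> y \<in> tl a}"
  define r' where "r' = {(p, q). p \<in> A' \<and> q \<in> A' \<and> snd q \<subseteq> snd p}"
  have ref: "(a, a) \<in> r" if "a \<in> A" for a
    using dir that by (auto simp: directed_set_def preorder_on_def refl_on_def)
  have sub: "r \<subseteq> A \<times> A" and tr: "trans r"
    using dir by (auto simp: directed_set_def preorder_on_def refl_on_def)
  have in_A': "(T a, tl a) \<in> A'" if "a \<in> A" for a
    using ref[OF that] that by (auto simp: A'_def tl_def)
  have tl_mono: "tl b \<subseteq> tl a" if "(a, b) \<in> r" for a b
    using that tr by (auto simp: tl_def dest: transD)
  have "\<exists>c\<in>A'. (p, c) \<in> r' \<and> (q, c) \<in> r'" if pq: "p \<in> A'" "q \<in> A'" for p q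
  proof -
    obtain a b where ab: "a \<in> A" "b \<in> A" "snd p = tl a" "snd q = tl b"
      using pq by (auto simp: A'_def)
    then obtain c where "c \<in> A" "(a, c) \<in> r" "(b, c) \<in> r"
      using dir unfolding directed_set_def by metis
    then show ?thesis
      using pq ab in_A' tl_mono by (intro bexI[of _ "(T c, tl c)"]) (auto simp: r'_def)
  qed
  moreover have "preorder_on A' r'"
    by (auto simp: preorder_on_def refl_on_def r'_def intro!: transI)
  moreover have "A' \<noteq> {}"
    using dir in_A' by (auto simp: directed_set_def)
  ultimately have dir': "directed_set A' r'"
    by (simp add: directed_set_def)
  have "eventually P (filtermap fst (net_filter A' r')) \<longleftrightarrow>
      eventually P (filtermap T (net_filter A r))" for P
  proof -
    have "eventually P (filtermap fst (net_filter A' r')) \<longleftrightarrow>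
        (\<exists>p\<in>A'. \<forall>q. (p, q) \<in> r' \<longrightarrow> P (fst q))"
      by (simp add: eventually_filtermap eventually_net_filter[OF dir'])
    also have "\<dots> \<longleftrightarrow> (\<exists>a\<in>A. \<forall>y\<in>tl a. P y)"
    proof
      assume "\<exists>p\<in>A'. \<forall>q. (p, q) \<in> r' \<longrightarrow> P (fst q)"
      then obtain p where p: "p \<in> A'" "\<And>q. (p, q) \<in> r' \<Longrightarrow> P (fst q)"
        by blast
      then obtain a where a: "a \<in> A" "snd p = tl a"
        by (auto simp: A'_def)
      have "P y" if "y \<in> tl a" for y
        using p(1) p(2)[of "(y, tl a)"] a that by (auto simp: r'_def A'_def)
      with a show "\<exists>a\<in>A. \<forall>y\<in>tl a. P y" by blast
    next
      assume "\<exists>a\<in>A. \<forall>y\<in>tl a. P y"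
      then obtain a where a: "a \<in> A" "\<forall>y\<in>tl a. P y" by blast
      have "P (fst q)" if "((T a, tl a), q) \<in> r'" for q
        using that a by (auto simp: r'_def A'_def)
      with in_A'[OF a(1)] show "\<exists>p\<in>A'. \<forall>q. (p, q) \<in> r' \<longrightarrow> P (fst q)" by blast
    qed
    also have "\<dots> \<longleftrightarrow> eventually P (filtermap T (net_filter A r))"
      by (auto simp: eventually_filtermap eventually_net_filter[OF dir] tl_def)
    finally show ?thesis .
  qed
  then have "filtermap fst (net_filter A' r') = filtermap T (net_filter A r)"
    by (simp add: filter_eq_iff)
  moreover have "fst ` A' \<subseteq> T ` A"
    using sub by (auto simp: A'_def tl_def)
  ultimately show ?thesis using dir' by blast
qed

definition left_mean_ergodic :: "('a::complex_lcs \<Rightarrow> 'a) set \<Rightarrow> bool" where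
  "left_mean_ergodic S \<longleftrightarrow>
     (\<forall>(A :: (('a \<Rightarrow> 'a) \<times> ('a \<Rightarrow> 'a) set) set) r T.
        left_ergodic_net S A r T \<longrightarrow> (\<forall>x. \<exists>y. ((\<lambda>\<alpha>. T \<alpha> x) \<longlongrightarrow> y) (net_filter A r)))"

lemma left_mean_ergodic_any_index:
  fixes S :: "('a::complex_lcs \<Rightarrow> 'a) set" and T :: "'i \<Rightarrow> 'a \<Rightarrow> 'a"
  assumes "left_mean_ergodic S" and net: "left_ergodic_net S A r T"
  shows "\<exists>y. ((\<lambda>\<alpha>. T \<alpha> x) \<longlongrightarrow> y) (net_filter A r)"
proof -
  have dir: "directed_set A r" and range: "T ` A \<subseteq> K_co S"
    and erg: "\<And>x R. R \<in> S \<Longrightarrow> ((\<lambda>\<alpha>. T \<alpha> x - R (T \<alpha> x)) \<longlongrightarrow> 0) (net_filter A r)"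
    using net by (auto simp: left_ergodic_net_def)
  obtain A' :: "(('a \<Rightarrow> 'a) \<times> ('a \<Rightarrow> 'a) set) set" and r' T' where
    dir': "directed_set A' r'" and range': "T' ` A' \<subseteq> T ` A"
    and eq: "filtermap T' (net_filter A' r') = filtermap T (net_filter A r)"
    using canonical_reindexing[OF dir, of T] by blast
  have tendsto_iff: "((\<lambda>\<alpha>. g (T' \<alpha>)) \<longlongrightarrow> l) (net_filter A' r') \<longleftrightarrow>
      ((\<lambda>\<alpha>. g (T \<alpha>)) \<longlongrightarrow> l) (net_filter A r)" for g :: "('a \<Rightarrow> 'a) \<Rightarrow> 'a" and l
    using eq by (metis filterlim_filtermap)
  have "left_ergodic_net S A' r' T'"
    using dir' range range' erg tendsto_iff[of "\<lambda>U. U x - R (U x)" 0 for x R]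
    by (auto simp: left_ergodic_net_def)
  with assms(1) obtain y where "((\<lambda>\<alpha>. T' \<alpha> x) \<longlongrightarrow> y) (net_filter A' r')"
    unfolding left_mean_ergodic_def by blast
  with tendsto_iff[of "\<lambda>U. U x"] show ?thesis by blast
qed

end

theory Submission
  imports Defs
begin

text \<open>Write \<open>K\<close> for \<open>K_co S\<close>. By Tychonoff's theorem \<open>K\<close> is a compact convex subset of \<open>X\<^sup>X\<close>, and it is
  a semigroup. Composition in \<open>K\<close> is continuous in its left argument, but in its right argument in general only
  when the left one is continuous, since a pointwise limit of continuous operators may fail to be
  continuous. All arguments respect this asymmetry.

  The central objects are the operators \<open>P \<in> K\<close> with \<open>T \<circ> P = P\<close> for all \<open>T \<in> S\<close>. Passing to convex
  combinations and limits of \<open>T\<close> gives \<open>R \<circ> P = P\<close> for all \<open>R \<in> K\<close> (\<open>K_co_absorbed\<close>).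

  If \<open>K\<close> has a zero \<open>Q\<close>, then every cluster point \<open>R \<in> K\<close> of a left ergodic net is such an operator,
  because the members of \<open>S\<close> are continuous. Hence \<open>R = Q \<circ> R = Q\<close>, and by compactness the net
  converges to \<open>Q\<close> (\<open>left_ergodic_net_tendsto_zero\<close>).

  Conversely, an invariant mean yields at least one such \<open>P\<close>, and mean ergodicity allows at most one:
  the sequence alternating between two of them is a left ergodic net, so it converges only if they
  agree. As each \<open>P \<circ> R\<close> with \<open>R \<in> K\<close> is again such an operator, \<open>P \<circ> R = P\<close>, and \<open>P\<close> is a zero.

  It remains to produce \<open>P\<close> from a mean \<open>\<mu>\<close> (\<open>left_amenable_imp_fixed_operator\<close>). Morally \<open>P\<close> is the
  barycentre of \<open>\<mu>\<close>. It is constructed without dual spaces: a partition of unity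
  \<open>p\<^sub>t, t \<in> F,\<close> on \<open>K\<close> with small supports gives the approximate barycentre
  \<open>b = \<Sum>t\<in>F. \<mu>(p\<^sub>t) t \<in> K\<close>. Invariance of \<open>\<mu>\<close> makes \<open>R \<circ> b - b\<close> as small as desired at finitely many
  pairs of an operator \<open>R \<in> S\<close> and a vector (\<open>barycentre_almost_fixed\<close>), and compactness of \<open>K\<close>
  removes both the error and the finiteness.\<close>

section \<open>Means on real functions\<close>

definition real_Cb :: "'s::topological_space set \<Rightarrow> ('s \<Rightarrow> real) set" where
  "real_Cb S = {f. continuous_on S f \<and> bounded (f ` S)}"

lemma real_Cb_interval:
  assumes "continuous_on S f" "\<And>t. t \<in> S \<Longrightarrow> 0 \<le> f t" "\<And>t. t \<in> S \<Longrightarrow> f t \<le> 1"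
  shows "f \<in> real_Cb S"
  using assms by (auto simp: real_Cb_def bounded_iff intro!: exI[of _ 1])

lemma real_Cb_diff:
  assumes "f \<in> real_Cb S" "g \<in> real_Cb S"
  shows "(\<lambda>t. f t - g t) \<in> real_Cb S"
  using assms bounded_minus_comp[of f S g] by (auto simp: real_Cb_def intro: continuous_on_diff)

lemma real_Cb_add:
  assumes "f \<in> real_Cb S" "g \<in> real_Cb S"
  shows "(\<lambda>t. f t + g t) \<in> real_Cb S"
  using assms bounded_plus_comp[of f S g] by (auto simp: real_Cb_def intro: continuous_on_add)

text \<open>Positivity only enters through real functions, so the mean is used in this real form. Functions are
  defined on the whole type; \<open>null\<close> says that the mean sees their values on \<open>S\<close> alone.\<close>

locale real_mean =
  fixes S :: "'s::topological_space set" and mul :: "'s \<Rightarrow> 's \<Rightarrow> 's"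
    and \<mu> :: "('s \<Rightarrow> real) \<Rightarrow> real"
  assumes add: "\<lbrakk>f \<in> real_Cb S; g \<in> real_Cb S\<rbrakk> \<Longrightarrow> \<mu> (\<lambda>t. f t + g t) = \<mu> f + \<mu> g"
    and nonneg: "\<lbrakk>f \<in> real_Cb S; \<And>t. t \<in> S \<Longrightarrow> 0 \<le> f t\<rbrakk> \<Longrightarrow> 0 \<le> \<mu> f"
    and null: "\<lbrakk>f \<in> real_Cb S; \<And>t. t \<in> S \<Longrightarrow> f t = 0\<rbrakk> \<Longrightarrow> \<mu> f = 0"
    and one: "\<mu> (\<lambda>t. 1) = 1"
    and invariant: "\<lbrakk>f \<in> real_Cb S; s \<in> S\<rbrakk> \<Longrightarrow> \<mu> (\<lambda>t. f (mul s t)) = \<mu> f"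
begin

lemma cong:
  assumes "f \<in> real_Cb S" "g \<in> real_Cb S" "\<And>t. t \<in> S \<Longrightarrow> f t = g t"
  shows "\<mu> f = \<mu> g"
proof -
  have "\<mu> (\<lambda>t. g t + (f t - g t)) = \<mu> g + \<mu> (\<lambda>t. f t - g t)"
    using assms by (intro add real_Cb_diff)
  moreover have "\<mu> (\<lambda>t. f t - g t) = 0"
    using assms by (intro null real_Cb_diff) auto
  ultimately show ?thesis by simp
qed

lemma sum:
  assumes "finite I" "\<And>i. i \<in> I \<Longrightarrow> f i \<in> real_Cb S"
  shows "(\<lambda>t. \<Sum>i\<in>I. f i t) \<in> real_Cb S \<and> \<mu> (\<lambda>t. \<Sum>i\<in>I. f i t) = (\<Sum>i\<in>I. \<mu> (f i))"
  using assms
proof (induction I)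
  case empty
  have "(\<lambda>t. 0) \<in> real_Cb S"
    by (rule real_Cb_interval) auto
  then show ?case using null[of "\<lambda>t. 0"] by simp
next
  case (insert i I)
  then show ?case using real_Cb_add[of "f i" S "\<lambda>t. \<Sum>i\<in>I. f i t"]
      add[of "f i" "\<lambda>t. \<Sum>i\<in>I. f i t"] by simp
qed

end

text \<open>Boundedness, applied with the bound \<open>0\<close> on \<open>S\<close>, makes the mean ignore values off \<open>S\<close>.\<close>


lemma left_invariant_mean_imp_real_mean:
  assumes m: "left_invariant_mean (top_of_set S) mul m"
  shows "real_mean S mul (\<lambda>f. Re (m (\<lambda>t. complex_of_real (f t))))"
proof -
  have Cb: "(\<lambda>t. complex_of_real (f t)) \<in> Cb (top_of_set S)" if "f \<in> real_Cb S" for f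
    using that by (auto simp: Cb_def real_Cb_def bounded_iff intro: continuous_on_of_real)
  have add: "\<And>f g. \<lbrakk>f \<in> Cb (top_of_set S); g \<in> Cb (top_of_set S)\<rbrakk> \<Longrightarrow>
      m (\<lambda>t. f t + g t) = m f + m g"
    and pos: "\<And>f. \<lbrakk>f \<in> Cb (top_of_set S); \<And>t. t \<in> S \<Longrightarrow> f t \<in> \<real>\<^sub>\<ge>\<^sub>0\<rbrakk> \<Longrightarrow> m f \<in> \<real>\<^sub>\<ge>\<^sub>0"
    and one: "m (\<lambda>t. 1) = 1"
    and inv: "\<And>f s. \<lbrakk>f \<in> Cb (top_of_set S); s \<in> S\<rbrakk> \<Longrightarrow> m (\<lambda>t. f (mul s t)) = m f"
    using m by (auto simp: left_invariant_mean_def)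
  obtain B where B: "\<And>f M. \<lbrakk>f \<in> Cb (top_of_set S); \<And>t. t \<in> S \<Longrightarrow> norm (f t) \<le> M\<rbrakk> \<Longrightarrow>
      norm (m f) \<le> B * M"
    using m unfolding left_invariant_mean_def by (metis topspace_euclidean_subtopology)
  show ?thesis
  proof
    fix f g assume "f \<in> real_Cb S" "g \<in> real_Cb S"
    then show "Re (m (\<lambda>t. complex_of_real (f t + g t))) =
        Re (m (\<lambda>t. complex_of_real (f t))) + Re (m (\<lambda>t. complex_of_real (g t)))"
      using add[OF Cb Cb] by simp
  next
    fix f assume "f \<in> real_Cb S" "\<And>t. t \<in> S \<Longrightarrow> 0 \<le> f t"
    then show "0 \<le> Re (m (\<lambda>t. complex_of_real (f t)))"
      using pos[OF Cb] by (auto simp: nonneg_Reals_of_real_iff complex_nonneg_Reals_iff)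
  next
    fix f assume "f \<in> real_Cb S" "\<And>t. t \<in> S \<Longrightarrow> f t = 0"
    then show "Re (m (\<lambda>t. complex_of_real (f t))) = 0"
      using B[OF Cb, of f 0] by simp
  next
    show "Re (m (\<lambda>t. complex_of_real 1)) = 1" using one by simp
  next
    fix f s assume "f \<in> real_Cb S" "s \<in> S"
    then show "Re (m (\<lambda>t. complex_of_real (f (mul s t)))) = Re (m (\<lambda>t. complex_of_real (f t)))"
      using inv[OF Cb] by simp
  qed
qed


section \<open>Partitions of unity on compact sets\<close>

text \<open>A compact Hausdorff space is normal, so Urysohn's lemma supplies a bump function at each point that
  vanishes off the prescribed neighbourhood. Finitely many of them have a positive sum on \<open>K\<close>, by
  which they are divided. The Hausdorff property is a hypothesis on the topology rather than a sort
  constraint, which lets the lemma apply to spaces of functions.\<close>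

lemma compact_partition_of_unity:
  fixes K :: "'s::topological_space set"
  assumes K: "compact K" and H: "Hausdorff_space (top_of_set K)"
    and N: "\<And>t. t \<in> K \<Longrightarrow> open (N t)" "\<And>t. t \<in> K \<Longrightarrow> t \<in> N t"
  obtains F and p :: "'s \<Rightarrow> 's \<Rightarrow> real" where "finite F" "F \<subseteq> K"
    "\<And>t. t \<in> F \<Longrightarrow> continuous_on K (p t)" "\<And>t s. t \<in> F \<Longrightarrow> s \<in> K \<Longrightarrow> 0 \<le> p t s"
    "\<And>s. s \<in> K \<Longrightarrow> (\<Sum>t\<in>F. p t s) = 1"
    "\<And>t s. \<lbrakk>t \<in> F; s \<in> K; p t s \<noteq> 0\<rbrakk> \<Longrightarrow> s \<in> N t"
proof -
  have normal: "normal_space (top_of_set K)"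
    using K H by (intro compact_Hausdorff_or_regular_imp_normal_space)
      (auto simp: compact_space_subtopology)
  have "\<exists>f::'s \<Rightarrow> real. continuous_on K f \<and> (\<forall>s\<in>K. 0 \<le> f s) \<and> f t = 1 \<and> (\<forall>s\<in>K - N t. f s = 0)"
    if t: "t \<in> K" for t
  proof -
    have "closedin (top_of_set K) {t}"
      using H t by (intro closedin_Hausdorff_singleton) auto
    moreover have "closedin (top_of_set K) (K - N t)"
      unfolding Diff_eq using N(1)[OF t] by (intro closedin_closed_Int) (simp add: closed_Compl)
    moreover have "disjnt (K - N t) {t}"
      using N(2)[OF t] by (auto simp: disjnt_def)
    ultimately obtain f where "continuous_map (top_of_set K) (top_of_set {0..1::real}) f"
        "f ` (K - N t) \<subseteq> {0}" "f ` {t} \<subseteq> {1}"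
      using Urysohn_lemma[OF normal, of "K - N t" "{t}" 0 1] by auto
    then show ?thesis
      by (intro exI[of _ f]) (auto simp: continuous_map_in_subtopology)
  qed
  then obtain f :: "'s \<Rightarrow> 's \<Rightarrow> real" where f: "\<And>t. t \<in> K \<Longrightarrow> continuous_on K (f t)"
      "\<And>t s. t \<in> K \<Longrightarrow> s \<in> K \<Longrightarrow> 0 \<le> f t s" "\<And>t. t \<in> K \<Longrightarrow> f t t = 1"
      "\<And>t s. t \<in> K \<Longrightarrow> s \<in> K - N t \<Longrightarrow> f t s = 0"
    by metis
  have "\<exists>A. open A \<and> A \<inter> K = f t -` {0<..} \<inter> K" if "t \<in> K" for t
    using f(1)[OF that] continuous_on_open_invariant[of K "f t"] open_greaterThan by blast
  then obtain A where A: "\<And>t. t \<in> K \<Longrightarrow> open (A t)"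
      "\<And>t. t \<in> K \<Longrightarrow> A t \<inter> K = f t -` {0<..} \<inter> K"
    by metis
  have "t \<in> A t" if "t \<in> K" for t
    using A(2)[OF that] f(3)[OF that] that by auto
  then have "K \<subseteq> (\<Union>t\<in>K. A t)" by blast
  then obtain F where F: "F \<subseteq> K" "finite F" "K \<subseteq> (\<Union>t\<in>F. A t)"
    using compactE_image[OF K, of K A] A(1) by metis
  define q where "q s = (\<Sum>t\<in>F. f t s)" for s
  have q: "q s > 0" if s: "s \<in> K" for s
  proof -
    obtain t where "t \<in> F" "s \<in> A t" using F s by blast
    then have "f t s > 0" using A(2)[of t] F s by auto
    then show ?thesis
      unfolding q_def using F f(2) s \<open>t \<in> F\<close> by (intro sum_pos2[of F t]) auto
  qed
  have q_cont: "continuous_on K q"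
    unfolding q_def using F f(1) by (intro continuous_on_sum) auto
  show thesis
  proof
    show "finite F" "F \<subseteq> K" by fact+
    show "continuous_on K (\<lambda>s. f t s / q s)" if "t \<in> F" for t
      using q q_cont f(1) F that by (intro continuous_on_divide) (auto dest!: q)
    show "0 \<le> f t s / q s" if "t \<in> F" "s \<in> K" for t s
      using q[OF that(2)] f(2)[of t s] F that by auto
    show "(\<Sum>t\<in>F. f t s / q s) = 1" if "s \<in> K" for s
      using q[OF that] by (simp add: sum_divide_distrib[symmetric] q_def[symmetric])
    show "s \<in> N t" if "t \<in> F" "s \<in> K" "f t s / q s \<noteq> 0" for t s
      using that f(4)[of t s] F by auto
  qed
qed


section \<open>The topological vector space of self-maps\<close>

lemma continuous_on_scaleR_complex_lcs:
  fixes f :: "'b::topological_space \<Rightarrow> 'a::complex_lcs"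
  assumes "continuous_on A f"
  shows "continuous_on A (\<lambda>x. r *\<^sub>R f x)"
proof -
  have "continuous_on A ((\<lambda>(c, x). c *\<^sub>C x) \<circ> (\<lambda>x. (complex_of_real r, f x)))"
    using assms by (intro continuous_on_compose continuous_intros
        continuous_on_subset[OF continuous_scaleC]) auto
  then show ?thesis by (simp add: o_def scaleR_eq_scaleC)
qed

lemma Hausdorff_space_fun: "Hausdorff_space (top_of_set (K :: ('b \<Rightarrow> 'a::t2_space) set))"
proof (rule Hausdorff_space_subtopology)
  show "Hausdorff_space (euclidean :: ('b \<Rightarrow> 'a) topology)"
    unfolding euclidean_product_topology[symmetric] Hausdorff_space_product_topology
    by (simp add: Hausdorff_space_def disjnt_def separation_t2)
qed

lemma continuous_on_eval: "continuous_on A (\<lambda>P :: 'b \<Rightarrow> 'a::topological_space. P x)"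
  by (rule continuous_on_subset[OF continuous_on_product_coordinates]) auto

lemma continuous_on_operator_eval:
  assumes "continuous_on UNIV T"
  shows "continuous_on A (\<lambda>P :: 'b \<Rightarrow> 'a::topological_space. T (P x))"
  by (rule continuous_on_compose2[OF assms continuous_on_eval]) auto

text \<open>Convex combination is separately continuous, which suffices: extend \<open>u f + v g \<in> closure C\<close> from \<open>C\<close>
  to its closure one argument at a time.\<close>

lemma convex_closure_fun:
  fixes C :: "('b \<Rightarrow> 'a::complex_lcs) set"
  assumes C: "convex C"
  shows "convex (closure C)"
proof (rule convexI)
  fix f g :: "'b \<Rightarrow> 'a" and u v :: real
  assume fg: "f \<in> closure C" "g \<in> closure C" and uv: "0 \<le> u" "0 \<le> v" "u + v = 1"
  have cont: "continuous_on UNIV (\<lambda>h. u *\<^sub>R h + v *\<^sub>R k)"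
      "continuous_on UNIV (\<lambda>h. u *\<^sub>R k + v *\<^sub>R h)" for k :: "'b \<Rightarrow> 'a"
    by (intro continuous_on_coordinatewise_then_product;
        auto simp: scaleR_fun_def plus_fun_def
          intro!: continuous_on_add continuous_on_scaleR_complex_lcs continuous_on_const
            continuous_on_eval)+
  have "u *\<^sub>R f + v *\<^sub>R k \<in> closure C" if "k \<in> C" for k
  proof -
    have "closure C \<subseteq> (\<lambda>h. u *\<^sub>R h + v *\<^sub>R k) -` closure C"
      using convexD[OF C _ that uv] closure_subset cont
      by (intro closure_minimal closed_vimage) auto
    then show ?thesis using fg by auto
  qed
  then have "closure C \<subseteq> (\<lambda>h. u *\<^sub>R f + v *\<^sub>R h) -` closure C"
    using cont by (intro closure_minimal closed_vimage) auto
  then show "u *\<^sub>R f + v *\<^sub>R g \<in> closure C" using fg by auto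
qed

lemma compact_PiE_UNIV:
  fixes C :: "'b \<Rightarrow> 'a::topological_space set"
  assumes "\<And>x. compact (C x)"
  shows "compact (PiE UNIV C)"
proof -
  have "compactin (product_topology (\<lambda>x. euclidean) UNIV) (PiE UNIV C)"
    using assms by (simp add: compactin_PiE)
  then show ?thesis by (simp add: euclidean_product_topology)
qed

lemma continuous_operatorsD:
  fixes T :: "'a::complex_lcs \<Rightarrow> 'a"
  assumes "T \<in> continuous_operators"
  shows "linear T" "continuous_on UNIV T"
proof -
  have T: "Vector_Spaces.linear scaleC scaleC T" "continuous_on UNIV T"
    using assms by (auto simp: continuous_operators_def)
  then have "module_hom scaleC scaleC T" by (simp add: Vector_Spaces.linear_def module_hom_def
    vector_space_def module_def)
  then show "linear T"
    by (intro linearI) (simp_all add: module_hom.add module_hom.scale scaleR_eq_scaleC)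
  show "continuous_on UNIV T" by fact
qed

text \<open>This takes the place of the Hahn-Banach theorem: a vector vanishes once it lies in the closure of
  every convex neighbourhood of \<open>0\<close>.\<close>

lemma convex_neighbourhood_avoiding:
  fixes y :: "'a::complex_lcs"
  assumes "y \<noteq> 0"
  obtains V where "open V" "convex V" "0 \<in> V" "y \<notin> closure V"
proof -
  obtain U W where UW: "open U" "open W" "0 \<in> U" "y \<in> W" "U \<inter> W = {}"
    using separation_t2[of 0 y] assms by auto
  then obtain V where V: "open V" "convex V" "0 \<in> V" "V \<subseteq> U"
    using locally_convex by blast
  then have "V \<subseteq> - W" using UW by auto
  then have "closure V \<subseteq> - W"
    using UW by (intro closure_minimal) auto
  then show thesis using that V UW by blast
qed

lemma neighbourhood_of_differences:
  fixes V :: "'a::topological_ab_group_add set"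
  assumes "open V" "0 \<in> V"
  obtains W where "open W" "0 \<in> W" "\<And>x y. x \<in> W \<Longrightarrow> y \<in> W \<Longrightarrow> x - y \<in> V"
proof -
  have "((\<lambda>p. fst p - snd p) \<longlongrightarrow> 0 - (0::'a)) (nhds 0 \<times>\<^sub>F nhds 0)"
    by (intro tendsto_diff filterlim_fst filterlim_snd)
  then have "eventually (\<lambda>p. fst p - snd p \<in> V) (nhds (0::'a) \<times>\<^sub>F nhds 0)"
    using assms by (simp add: tendsto_def)
  then obtain P Q where PQ: "eventually P (nhds (0::'a))" "eventually Q (nhds (0::'a))"
      "\<And>x y. P x \<Longrightarrow> Q y \<Longrightarrow> x - y \<in> V"
    by (auto simp: eventually_prod_filter)
  have "eventually (\<lambda>x. P x \<and> Q x) (nhds (0::'a))" using PQ by (simp add: eventually_conj)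
  then obtain W where "open W" "0 \<in> W" "\<forall>x\<in>W. P x \<and> Q x"
    by (auto simp: eventually_nhds)
  then show thesis using that PQ(3) by blast
qed


section \<open>The closed convex semigroup\<close>

lemma K_co_superset: "S \<subseteq> K_co S"
  unfolding K_co_def using hull_subset closure_subset by (metis subset_trans)

text \<open>The induction principle for \<open>K_co S\<close>: a closed convex property extends from \<open>S\<close>.\<close>

lemma K_co_minimal:
  assumes "S \<subseteq> C" "convex C" "closed C"
  shows "K_co S \<subseteq> C"
  unfolding K_co_def using assms by (intro closure_minimal hull_minimal)

lemma convex_K_co: "convex (K_co S)"
  unfolding K_co_def by (intro convex_closure_fun convex_convex_hull)

lemma closed_K_co: "closed (K_co S)"
  by (simp add: K_co_def)

text \<open>\<open>K_co S\<close> is a closed subset of the product of the orbit closures, which is compact by Tychonoff's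
  theorem.\<close>

lemma compact_K_co:
  fixes S :: "('a::complex_lcs \<Rightarrow> 'a) set"
  assumes "\<And>x. compact (closure ((\<lambda>T. T x) ` (convex hull S)))"
  shows "compact (K_co S)"
proof -
  let ?C = "\<lambda>x. closure ((\<lambda>T. T x) ` (convex hull S))"
  have eq: "PiE UNIV ?C = (\<Inter>x. (\<lambda>P. P x) -` ?C x)"
    by (auto simp: PiE_def)
  have "closed (PiE UNIV ?C)"
    unfolding eq by (intro closed_INT ballI closed_vimage closed_closure continuous_on_eval)
  then have "K_co S \<subseteq> PiE UNIV ?C"
    unfolding K_co_def
    by (rule closure_minimal[rotated]) (use closure_subset in \<open>fastforce simp: eq\<close>)
  then show ?thesis
    using compact_Int_closed[OF compact_PiE_UNIV[of ?C, OF assms] closed_K_co[of S]]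
    by (simp add: Int_absorb1)
qed

lemma linear_preimage_K_co:
  assumes "S \<subseteq> h -` K_co S" "continuous_on UNIV h"
    and "\<And>f g u v. h (u *\<^sub>R f + v *\<^sub>R g) = u *\<^sub>R h f + v *\<^sub>R h g"
  shows "K_co S \<subseteq> h -` K_co S"
proof (rule K_co_minimal)
  show "convex (h -` K_co S)"
    by (rule convexI) (simp add: assms(3) convexD[OF convex_K_co])
  show "closed (h -` K_co S)"
    using closed_K_co assms(2) by (rule closed_vimage)
qed fact

lemma continuous_on_comp_left:
  assumes "continuous_on UNIV R"
  shows "continuous_on A (\<lambda>P :: 'b \<Rightarrow> 'a::topological_space. R \<circ> P)"
  using continuous_on_operator_eval[OF assms]
  by (auto simp: o_def intro!: continuous_on_coordinatewise_then_product)

lemma continuous_on_comp_right: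
  "continuous_on A (\<lambda>R :: 'b \<Rightarrow> 'a::topological_space. R \<circ> P)"
  using continuous_on_eval
  by (auto simp: o_def intro!: continuous_on_coordinatewise_then_product)

text \<open>The two factors have to be extended from \<open>S\<close> to \<open>K_co S\<close> in this order: first the right one, while
  the left one is a continuous operator, and then the left one, where composition is always
  continuous.\<close>

lemma K_co_comp:
  assumes S: "operator_semigroup S" and P: "P \<in> K_co S" and R: "R \<in> K_co S"
  shows "P \<circ> R \<in> K_co S"
proof -
  have left: "K_co S \<subseteq> (\<lambda>R. T \<circ> R) -` K_co S" if T: "T \<in> S" for T
  proof (rule linear_preimage_K_co)
    have T': "T \<in> continuous_operators" using S T by (auto simp: operator_semigroup_def)
    show "S \<subseteq> (\<lambda>R. T \<circ> R) -` K_co S"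
      using S T subsetD[OF K_co_superset[of S]] by (auto simp: operator_semigroup_def)
    show "continuous_on UNIV (\<lambda>R. T \<circ> R)"
      by (rule continuous_on_comp_left[OF continuous_operatorsD(2)[OF T']])
    show "T \<circ> (u *\<^sub>R f + v *\<^sub>R g) = u *\<^sub>R (T \<circ> f) + v *\<^sub>R (T \<circ> g)" for f g u v
      using continuous_operatorsD(1)[OF T']
      by (simp add: fun_eq_iff scaleR_fun_def linear_add linear_scale)
  qed
  have "K_co S \<subseteq> (\<lambda>P. P \<circ> R) -` K_co S"
    using left R
    by (intro linear_preimage_K_co continuous_on_comp_right)
      (auto simp: fun_eq_iff scaleR_fun_def)
  then show ?thesis using P by auto
qed

lemma K_co_absorbed:
  fixes S :: "('a::complex_lcs \<Rightarrow> 'a) set"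
  assumes fixed: "\<And>T. T \<in> S \<Longrightarrow> T \<circ> P = P" and R: "R \<in> K_co S"
  shows "R \<circ> P = P"
proof -
  have eq: "{R. R \<circ> P = P} = (\<Inter>x. (\<lambda>R. R (P x)) -` {P x})"
    by (auto simp: fun_eq_iff)
  have "K_co S \<subseteq> {R. R \<circ> P = P}"
  proof (rule K_co_minimal)
    show "S \<subseteq> {R. R \<circ> P = P}" using fixed by auto
    show "convex {R. R \<circ> P = P}"
      by (auto simp: convex_def fun_eq_iff scaleR_fun_def scaleR_add_left[symmetric])
    show "closed {R. R \<circ> P = P}"
      unfolding eq by (intro closed_INT ballI closed_vimage closed_singleton continuous_on_eval)
  qed
  then show ?thesis using R by auto
qed


section \<open>Fixed operators from invariant means\<close>

lemma sum_fun_apply: "(\<Sum>i\<in>I. f i) x = (\<Sum>i\<in>I. f i x)"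
  by (induction I rule: infinite_finite_induct) auto

text \<open>Let \<open>(p\<^sub>t)\<close> be a partition of unity on \<open>K_co S\<close>, put \<open>b = \<Sum>t. \<mu>(p\<^sub>t) t\<close> and
  \<open>a t u = \<mu>(\<lambda>s. p\<^sub>t(s) p\<^sub>u(R \<circ> s))\<close>. The row sums of this matrix are \<open>\<mu>(p\<^sub>t)\<close>, and by invariance its
  column sums are \<open>\<mu>(p\<^sub>u)\<close>. Therefore \<open>R (b x) - b x\<close> is the convex combination of the differences
  \<open>R (t x) - u x\<close> with the weights \<open>a t u\<close>. A weight can be nonzero only if some \<open>s \<in> S\<close> is close to
  \<open>t\<close> while \<open>R \<circ> s\<close> is close to \<open>u\<close>, and then \<open>R (t x)\<close> and \<open>u x\<close> are both close to \<open>R (s x)\<close>.\<close>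

lemma barycentre_almost_fixed:
  fixes S :: "('a::complex_lcs \<Rightarrow> 'a) set"
  assumes S: "operator_semigroup S" and "real_mean S (\<circ>) \<mu>"
    and K: "compact (K_co S)"
    and D: "finite D" "\<And>R x V. (R, x, V) \<in> D \<Longrightarrow> R \<in> S \<and> open V \<and> convex V \<and> 0 \<in> V"
  shows "\<exists>b\<in>K_co S. \<forall>(R, x, V)\<in>D. R (b x) - b x \<in> V"
proof -
  interpret real_mean S "(\<circ>)" \<mu> by fact
  let ?K = "K_co S"
  have op: "linear R" "continuous_on UNIV R" if "R \<in> S" for R
    using S that continuous_operatorsD[of R] by (auto simp: operator_semigroup_def)
  have comp: "R \<circ> T \<in> S" if "R \<in> S" "T \<in> S" for R T
    using S that by (auto simp: operator_semigroup_def)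
  have "\<forall>d\<in>D. \<exists>W. open W \<and> 0 \<in> W \<and> (\<forall>x\<in>W. \<forall>y\<in>W. x - y \<in> snd (snd d))"
  proof
    fix d assume "d \<in> D"
    then have "open (snd (snd d))" "0 \<in> snd (snd d)"
      using D(2)[of "fst d" "fst (snd d)" "snd (snd d)"] by auto
    then show "\<exists>W. open W \<and> 0 \<in> W \<and> (\<forall>x\<in>W. \<forall>y\<in>W. x - y \<in> snd (snd d))"
      by (rule neighbourhood_of_differences) blast
  qed
  then obtain W where W: "\<And>d. d \<in> D \<Longrightarrow> open (W d)" "\<And>d. d \<in> D \<Longrightarrow> 0 \<in> W d"
      "\<And>d x y. \<lbrakk>d \<in> D; x \<in> W d; y \<in> W d\<rbrakk> \<Longrightarrow> x - y \<in> snd (snd d)"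
    by metis
  \<comment> \<open>Closeness to \<open>t\<close> is required both before and after applying \<open>R\<close>, as \<open>t\<close> occurs in both roles.\<close>
  define N where "N t = (\<Inter>d\<in>D. (\<lambda>P. P (fst (snd d)) - t (fst (snd d))) -` W d \<inter>
      (\<lambda>P. fst d (P (fst (snd d))) - fst d (t (fst (snd d)))) -` W d)" for t
  have N_open: "open (N t)" for t
    unfolding N_def
  proof (intro open_INT ballI D(1) open_Int open_vimage)
    fix d assume d: "d \<in> D"
    then show "open (W d)" "open (W d)" using W by auto
    have "continuous_on UNIV (fst d)"
      using D(2)[of "fst d" "fst (snd d)" "snd (snd d)"] d op by auto
    then show "continuous_on UNIV (\<lambda>P. fst d (P (fst (snd d))) - fst d (t (fst (snd d))))"
      by (intro continuous_on_diff continuous_on_operator_eval continuous_on_const)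
    show "continuous_on UNIV (\<lambda>P. P (fst (snd d)) - t (fst (snd d)))"
      by (intro continuous_on_diff continuous_on_eval continuous_on_const)
  qed
  have N_self: "t \<in> N t" for t
    using W by (auto simp: N_def)
  obtain F and p :: "('a \<Rightarrow> 'a) \<Rightarrow> ('a \<Rightarrow> 'a) \<Rightarrow> real" where F: "finite F" "F \<subseteq> ?K"
    and p_cont: "\<And>t. t \<in> F \<Longrightarrow> continuous_on ?K (p t)"
    and p_nonneg: "\<And>t s. t \<in> F \<Longrightarrow> s \<in> ?K \<Longrightarrow> 0 \<le> p t s"
    and p_sum: "\<And>s. s \<in> ?K \<Longrightarrow> (\<Sum>t\<in>F. p t s) = 1"
    and p_supp: "\<And>t s. \<lbrakk>t \<in> F; s \<in> ?K; p t s \<noteq> 0\<rbrakk> \<Longrightarrow> s \<in> N t"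
    using compact_partition_of_unity[OF K Hausdorff_space_fun, of N] N_open N_self by blast
  have SK: "s \<in> ?K" if "s \<in> S" for s using that K_co_superset by blast
  have p_le: "p t s \<le> 1" if "t \<in> F" "s \<in> ?K" for t s
    using member_le_sum[of t F "\<lambda>t. p t s"] p_nonneg p_sum[of s] F that by auto
  have p_S: "continuous_on S (p t)" if "t \<in> F" for t
    using p_cont[OF that] K_co_superset by (rule continuous_on_subset)
  have p_Cb: "p t \<in> real_Cb S" if "t \<in> F" for t
    using that p_S p_nonneg p_le SK by (intro real_Cb_interval) auto
  define b where "b = (\<Sum>t\<in>F. \<mu> (p t) *\<^sub>R t)"
  have one_Cb: "(\<lambda>t. 1) \<in> real_Cb S" by (rule real_Cb_interval) auto
  have "(\<Sum>t\<in>F. \<mu> (p t)) = \<mu> (\<lambda>s. \<Sum>t\<in>F. p t s)"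
    using sum[of F p] F p_Cb by auto
  also have "\<dots> = 1"
    using cong[of "\<lambda>s. \<Sum>t\<in>F. p t s" "\<lambda>s. 1"] sum[of F p] F p_Cb one_Cb p_sum SK one by auto
  finally have mass: "(\<Sum>t\<in>F. \<mu> (p t)) = 1" .
  have "b \<in> ?K"
    unfolding b_def using F mass convex_K_co p_Cb p_nonneg SK
    by (intro convex_sum nonneg) auto
  have almost_fixed: "R (b x) - b x \<in> V" if d: "(R, x, V) \<in> D" for R x V
  proof -
    have R: "R \<in> S" and V: "open V" "convex V" "0 \<in> V" using D(2)[OF d] by auto
    define a where "a t u = \<mu> (\<lambda>s. p t s * p u (R \<circ> s))" for t u
    have shift_cont: "continuous_on S (\<lambda>s. p u (R \<circ> s))" if "u \<in> F" for u
      using comp[OF R]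
      by (intro continuous_on_compose2[OF p_S[OF that] continuous_on_comp_left[OF op(2)[OF R]]]) auto
    have shift_Cb: "(\<lambda>s. p u (R \<circ> s)) \<in> real_Cb S" if "u \<in> F" for u
      using shift_cont p_nonneg p_le SK comp[OF R] that by (intro real_Cb_interval) auto
    have prod_nonneg: "0 \<le> p t s * p u (R \<circ> s)" if "t \<in> F" "u \<in> F" "s \<in> S" for t u s
      using p_nonneg SK comp[OF R] that by auto
    have prod_Cb: "(\<lambda>s. p t s * p u (R \<circ> s)) \<in> real_Cb S" if "t \<in> F" "u \<in> F" for t u
      using that p_nonneg p_le SK comp[OF R] p_S shift_cont
      by (intro real_Cb_interval continuous_on_mult) (auto intro!: mult_le_one)
    have row: "(\<Sum>u\<in>F. a t u) = \<mu> (p t)" if t: "t \<in> F" for t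
    proof -
      have "(\<Sum>u\<in>F. a t u) = \<mu> (\<lambda>s. \<Sum>u\<in>F. p t s * p u (R \<circ> s))"
        unfolding a_def using sum[of F "\<lambda>u s. p t s * p u (R \<circ> s)"] F prod_Cb[OF t] by simp
      also have "\<dots> = \<mu> (p t)"
        using sum[of F "\<lambda>u s. p t s * p u (R \<circ> s)"] F prod_Cb[OF t] p_Cb[OF t] p_sum SK comp[OF R]
        by (intro cong) (auto simp: sum_distrib_left[symmetric])
      finally show ?thesis .
    qed
    have column: "(\<Sum>t\<in>F. a t u) = \<mu> (p u)" if u: "u \<in> F" for u
    proof -
      have "(\<Sum>t\<in>F. a t u) = \<mu> (\<lambda>s. \<Sum>t\<in>F. p t s * p u (R \<circ> s))"
        unfolding a_def using sum[of F "\<lambda>t s. p t s * p u (R \<circ> s)"] F prod_Cb[OF _ u] by simp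
      also have "\<dots> = \<mu> (\<lambda>s. p u (R \<circ> s))"
        using sum[of F "\<lambda>t s. p t s * p u (R \<circ> s)"] F prod_Cb[OF _ u] shift_Cb[OF u] p_sum SK
        by (intro cong) (auto simp: sum_distrib_right[symmetric])
      also have "\<dots> = \<mu> (p u)" using invariant[OF p_Cb[OF u] R] .
      finally show ?thesis .
    qed
    have near: "R (t x) - u x \<in> V" if tu: "t \<in> F" "u \<in> F" "a t u \<noteq> 0" for t u
    proof -
      obtain s where s: "s \<in> S" "p t s * p u (R \<circ> s) \<noteq> 0"
        using null[OF prod_Cb[OF tu(1,2)]] tu(3) by (auto simp: a_def)
      then have "s \<in> N t" "R \<circ> s \<in> N u"
        using p_supp[OF tu(1), of s] p_supp[OF tu(2), of "R \<circ> s"] SK comp[OF R] by auto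
      then have "R (s x) - R (t x) \<in> W (R, x, V)" "R (s x) - u x \<in> W (R, x, V)"
        using d by (auto simp: N_def)
      then have "(R (s x) - u x) - (R (s x) - R (t x)) \<in> V"
        using W(3)[OF d, of "R (s x) - u x" "R (s x) - R (t x)"] by simp
      moreover have "(R (s x) - u x) - (R (s x) - R (t x)) = R (t x) - u x"
        by (simp only: algebra_simps)
      ultimately show ?thesis by metis
    qed
    have Rb: "R (b x) = (\<Sum>t\<in>F. \<Sum>u\<in>F. a t u *\<^sub>R R (t x))"
      using row by (simp add: b_def sum_fun_apply scaleR_fun_def linear_sum[OF op(1)[OF R]]
          linear_scale[OF op(1)[OF R]] scaleR_sum_left[symmetric])
    have "b x = (\<Sum>u\<in>F. \<Sum>t\<in>F. a t u *\<^sub>R u x)"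
      using column by (simp add: b_def sum_fun_apply scaleR_fun_def scaleR_sum_left[symmetric])
    also have "\<dots> = (\<Sum>t\<in>F. \<Sum>u\<in>F. a t u *\<^sub>R u x)" by (rule sum.swap)
    finally have bx: "b x = (\<Sum>t\<in>F. \<Sum>u\<in>F. a t u *\<^sub>R u x)" .
    have "R (b x) - b x = (\<Sum>t\<in>F. \<Sum>u\<in>F. a t u *\<^sub>R (R (t x) - u x))"
      unfolding Rb unfolding bx by (simp add: sum_subtractf scaleR_diff_right)
    \<comment> \<open>Differences of weight zero are replaced by \<open>0 \<in> V\<close>, as nothing is known about them.\<close>
    also have "\<dots> = (\<Sum>(t, u)\<in>F \<times> F. a t u *\<^sub>R (if a t u = 0 then 0 else R (t x) - u x))"
      by (auto simp: sum.cartesian_product intro!: sum.cong)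
    also have "\<dots> = (\<Sum>q\<in>F \<times> F. a (fst q) (snd q) *\<^sub>R
        (if a (fst q) (snd q) = 0 then 0 else R (fst q x) - snd q x))"
      by (simp add: case_prod_beta)
    also have "\<dots> \<in> V"
    proof (rule convex_sum[OF _ V(2)])
      show "finite (F \<times> F)" using F by simp
      show "(\<Sum>q\<in>F \<times> F. a (fst q) (snd q)) = 1"
      proof -
        have "(\<Sum>q\<in>F \<times> F. a (fst q) (snd q)) = (\<Sum>t\<in>F. \<Sum>u\<in>F. a t u)"
          by (simp add: sum.cartesian_product case_prod_beta)
        then show ?thesis using row mass by simp
      qed
      show "0 \<le> a (fst q) (snd q)" if "q \<in> F \<times> F" for q
        unfolding a_def using that prod_Cb prod_nonneg by (intro nonneg) auto
      show "(if a (fst q) (snd q) = 0 then 0 else R (fst q x) - snd q x) \<in> V"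
        if "q \<in> F \<times> F" for q
        using that V(3) near by auto
    qed
    finally show ?thesis .
  qed
  show ?thesis
  proof (intro bexI ballI)
    fix d assume "d \<in> D"
    then show "case d of (R, x, V) \<Rightarrow> R (b x) - b x \<in> V"
      by (cases d) (simp only: split almost_fixed)
  qed fact
qed

text \<open>The operators that are almost fixed for one choice of operator, vector and neighbourhood form a closed
  subset of the compact set \<open>K_co S\<close>. These subsets have the finite intersection property by
  \<open>barycentre_almost_fixed\<close>, and a common element is fixed exactly.\<close>

lemma left_amenable_imp_fixed_operator:
  fixes S :: "('a::complex_lcs \<Rightarrow> 'a) set"
  assumes S: "operator_semigroup S" and amenable: "left_amenable (top_of_set S) (\<circ>)"
    and K: "compact (K_co S)"
  obtains P where "P \<in> K_co S" "\<And>T. T \<in> S \<Longrightarrow> T \<circ> P = P"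
proof -
  obtain \<mu> where \<mu>: "real_mean S (\<circ>) \<mu>"
    using amenable left_invariant_mean_imp_real_mean by (auto simp: left_amenable_def)
  define I where "I = {(R :: 'a \<Rightarrow> 'a, x :: 'a, V :: 'a set). R \<in> S \<and> open V \<and> convex V \<and> 0 \<in> V}"
  define C where "C = (\<lambda>(R :: 'a \<Rightarrow> 'a, x :: 'a, V). (\<lambda>P. R (P x) - P x) -` closure V)"
  have "K_co S \<inter> (\<Inter>d\<in>I. C d) \<noteq> {}"
  proof (rule compact_imp_fip_image[OF K])
    fix d assume "d \<in> I"
    then obtain R x V where d: "d = (R, x, V)" "R \<in> S" by (auto simp: I_def)
    then have "continuous_on UNIV R"
      using S by (auto simp: operator_semigroup_def dest: continuous_operatorsD)
    then show "closed (C d)"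
      unfolding C_def d(1) split
      by (intro closed_vimage closed_closure continuous_on_diff continuous_on_operator_eval
          continuous_on_eval)
  next
    fix D assume D: "finite D" "D \<subseteq> I"
    have "\<exists>b\<in>K_co S. \<forall>(R, x, V)\<in>D. R (b x) - b x \<in> V"
      using D by (intro barycentre_almost_fixed[OF S \<mu> K]) (auto simp: I_def)
    then obtain b where "b \<in> K_co S" "\<forall>(R, x, V)\<in>D. R (b x) - b x \<in> V" by blast
    then have "b \<in> K_co S \<inter> (\<Inter>d\<in>D. C d)"
      using closure_subset by (fastforce simp: C_def)
    then show "K_co S \<inter> (\<Inter>d\<in>D. C d) \<noteq> {}" by blast
  qed
  then obtain P where "P \<in> K_co S \<inter> (\<Inter>d\<in>I. C d)" by fast
  then have P: "P \<in> K_co S" "\<And>d. d \<in> I \<Longrightarrow> P \<in> C d" by simp_all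
  have "T (P x) = P x" if "T \<in> S" for T x
  proof (rule ccontr)
    assume "T (P x) \<noteq> P x"
    then have "T (P x) - P x \<noteq> 0" by simp
    then obtain V where "open V" "convex V" "0 \<in> V" "T (P x) - P x \<notin> closure V"
      by (rule convex_neighbourhood_avoiding)
    then show False using P(2)[of "(T, x, V)"] that by (auto simp: I_def C_def)
  qed
  then have "T \<circ> P = P" if "T \<in> S" for T
    using that by (simp add: fun_eq_iff)
  with P(1) show thesis by (rule that)
qed


section \<open>Ergodic nets\<close>

lemma net_filter_nat: "net_filter UNIV {(m, n :: nat). m \<le> n} = sequentially"
  and directed_nat: "directed_set UNIV {(m, n :: nat). m \<le> n}"
proof -
  show dir: "directed_set UNIV {(m, n :: nat). m \<le> n}"
    by (auto simp: directed_set_def preorder_on_def refl_on_def intro!: transI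
        intro: max.cobounded1 max.cobounded2)
  show "net_filter UNIV {(m, n :: nat). m \<le> n} = sequentially"
    by (simp add: filter_eq_iff eventually_net_filter[OF dir] eventually_sequentially)
qed

text \<open>The sequence \<open>P, R, P, R, \<dots>\<close> is a left ergodic net, so it converges pointwise.\<close>

lemma left_mean_ergodic_fixed_operator_unique:
  assumes erg: "left_mean_ergodic S"
    and P: "P \<in> K_co S" "\<And>T. T \<in> S \<Longrightarrow> T \<circ> P = P"
    and R: "R \<in> K_co S" "\<And>T. T \<in> S \<Longrightarrow> T \<circ> R = R"
  shows "P = R"
proof
  fix x
  let ?T = "\<lambda>n :: nat. if even n then P else R"
  have "left_ergodic_net S UNIV {(m, n :: nat). m \<le> n} ?T"
    unfolding left_ergodic_net_def
  proof (intro conjI allI ballI directed_nat)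
    show "range ?T \<subseteq> K_co S" using P R by auto
    fix y T assume "T \<in> S"
    then have "?T n y - T (?T n y) = 0" for n
      using fun_cong[OF P(2), of T y] fun_cong[OF R(2), of T y] by simp
    then show "((\<lambda>n. ?T n y - T (?T n y)) \<longlongrightarrow> 0) (net_filter UNIV {(m, n :: nat). m \<le> n})"
      by (simp only: tendsto_const)
  qed
  from left_mean_ergodic_any_index[OF erg this, of x]
  obtain y where "(\<lambda>n. ?T n x) \<longlonglongrightarrow> y"
    unfolding net_filter_nat by (rule exE)
  then have "((\<lambda>n. ?T n x) \<circ> (\<lambda>n. 2 * n)) \<longlonglongrightarrow> y" "((\<lambda>n. ?T n x) \<circ> (\<lambda>n. 2 * n + 1)) \<longlonglongrightarrow> y"
    by (rule LIMSEQ_subseq_LIMSEQ; simp add: strict_mono_def)+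
  then have "(\<lambda>n :: nat. P x) \<longlonglongrightarrow> y" "(\<lambda>n :: nat. R x) \<longlonglongrightarrow> y"
    by (simp_all add: o_def)
  then show "P x = R x" by (simp add: LIMSEQ_const_iff)
qed

text \<open>If the net were not eventually in the neighbourhood \<open>U\<close> of \<open>Q\<close>, compactness would provide a cluster
  point \<open>R\<close> of the part of the net outside \<open>U\<close>. But every cluster point satisfies \<open>B \<circ> R = R\<close> for
  \<open>B \<in> S\<close>, hence \<open>R = Q \<circ> R = Q\<close>.\<close>

lemma left_ergodic_net_tendsto_zero:
  fixes S :: "('a::complex_lcs \<Rightarrow> 'a) set"
  assumes S: "operator_semigroup S" and K: "compact (K_co S)"
    and Q: "semigroup_zero (K_co S) Q"
    and net: "left_ergodic_net S A r T"
  shows "((\<lambda>\<alpha>. T \<alpha> x) \<longlongrightarrow> Q x) (net_filter A r)"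
proof -
  have dir: "directed_set A r" and range: "T ` A \<subseteq> K_co S"
    and erg: "\<And>x R. R \<in> S \<Longrightarrow> ((\<lambda>\<alpha>. T \<alpha> x - R (T \<alpha> x)) \<longlongrightarrow> 0) (net_filter A r)"
    using net by (auto simp: left_ergodic_net_def)
  define G where "G = filtermap T (net_filter A r)"
  have in_K: "eventually (\<lambda>P. P \<in> K_co S) G"
  proof -
    obtain a where "a \<in> A" using dir by (auto simp: directed_set_def)
    moreover have "r \<subseteq> A \<times> A"
      using dir by (auto simp: directed_set_def preorder_on_def refl_on_def)
    ultimately show ?thesis
      using range by (auto simp: G_def eventually_filtermap eventually_net_filter[OF dir])
  qed
  have near: "eventually (\<lambda>P. P \<in> U) G" if U: "open U" "Q \<in> U" for U
  proof (rule ccontr)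
    assume "\<not> eventually (\<lambda>P. P \<in> U) G"
    then have "inf G (principal (- U)) \<noteq> bot"
      by (auto simp: trivial_limit_def eventually_inf_principal)
    moreover have "eventually (\<lambda>P. P \<in> K_co S) (inf G (principal (- U)))"
      using in_K by (rule filter_leD[OF inf_le1])
    ultimately obtain R where R: "R \<in> K_co S"
        "inf (nhds R) (inf G (principal (- U))) \<noteq> bot"
      using K unfolding compact_filter by blast
    let ?H = "inf (nhds R) (inf G (principal (- U)))"
    have fixed: "B \<circ> R = R" if B: "B \<in> S" for B
    proof
      fix y :: 'a
      have cont: "continuous_on UNIV B"
        using S B by (auto simp: operator_semigroup_def dest: continuous_operatorsD)
      let ?g = "\<lambda>P. P y - B (P y)"
      have "continuous_on UNIV ?g"
        by (intro continuous_on_diff continuous_on_eval continuous_on_operator_eval[OF cont])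
      then have "(?g \<longlongrightarrow> ?g R) (at R)"
        by (simp add: continuous_on_def)
      then have "(?g \<longlongrightarrow> R y - B (R y)) (nhds R)"
        by (simp only: tendsto_at_iff_tendsto_nhds[of ?g R])
      then have "((\<lambda>P. P y - B (P y)) \<longlongrightarrow> R y - B (R y)) ?H"
        by (rule tendsto_mono[OF inf_le1])
      moreover have "((\<lambda>P. P y - B (P y)) \<longlongrightarrow> 0) G"
        using erg[OF B, of y] by (simp add: G_def filterlim_filtermap)
      then have "((\<lambda>P. P y - B (P y)) \<longlongrightarrow> 0) ?H"
        by (rule tendsto_mono[rotated]) (simp add: le_infI1 le_infI2)
      ultimately have "R y - B (R y) = 0"
        using R(2) tendsto_unique by blast
      then show "(B \<circ> R) y = R y" by simp
    qed
    have "Q \<circ> R = R"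
      using K_co_absorbed[OF fixed] Q by (auto simp: semigroup_zero_def)
    then have "R = Q"
      using Q R by (auto simp: semigroup_zero_def)
    then have "eventually (\<lambda>P. P \<in> U) (nhds R)"
      using U by (simp add: eventually_nhds) blast
    then have "eventually (\<lambda>P. P \<in> U) ?H"
      by (rule filter_leD[OF inf_le1])
    moreover have "eventually (\<lambda>P. P \<notin> U) ?H"
      by (rule filter_leD[of _ "principal (- U)"]) (auto simp: le_infI2 eventually_principal)
    ultimately have "eventually (\<lambda>P. False) ?H"
      by eventually_elim simp
    then show False using R(2) by simp
  qed
  show ?thesis
  proof (rule topological_tendstoI)
    fix V assume "open V" "Q x \<in> V"
    then have "eventually (\<lambda>P. P \<in> (\<lambda>P. P x) -` V) G"
      by (intro near open_vimage continuous_on_eval) auto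
    then show "eventually (\<lambda>\<alpha>. T \<alpha> x \<in> V) (net_filter A r)"
      by (simp add: G_def eventually_filtermap)
  qed
qed

theorem theorem4p3:
  fixes S :: "('a::complex_lcs \<Rightarrow> 'a) set"
  assumes "operator_semigroup S"
    and "left_amenable (top_of_set S) (\<circ>)"
    and "\<And>x. compact (closure ((\<lambda>T. T x) ` (convex hull S)))"
  shows "(left_mean_ergodic S \<longleftrightarrow> (\<exists>Q. semigroup_zero (K_co S) Q)) \<and>
    (\<forall>Q. semigroup_zero (K_co S) Q \<longrightarrow>
      (\<forall>(A :: 'i set) r T. left_ergodic_net S A r T \<longrightarrow>
        (\<forall>x. ((\<lambda>\<alpha>. T \<alpha> x) \<longlongrightarrow> Q x) (net_filter A r))))"
proof -
  have K: "compact (K_co S)" using assms(3) by (rule compact_K_co)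
  have "\<exists>Q. semigroup_zero (K_co S) Q" if erg: "left_mean_ergodic S"
  proof -
    obtain P where P: "P \<in> K_co S" "\<And>T. T \<in> S \<Longrightarrow> T \<circ> P = P"
      using left_amenable_imp_fixed_operator[OF assms(1,2) K] by blast
    have "P \<circ> R = P" if "R \<in> K_co S" for R
    proof (rule left_mean_ergodic_fixed_operator_unique[OF erg])
      show "P \<circ> R \<in> K_co S" using K_co_comp[OF assms(1) P(1) that] .
      show "T \<circ> (P \<circ> R) = P \<circ> R" if "T \<in> S" for T
        using P(2)[OF that] by (simp add: comp_assoc[symmetric])
    qed (use P in auto)
    moreover have "R \<circ> P = P" if "R \<in> K_co S" for R
      using K_co_absorbed[OF P(2) that] .
    ultimately show ?thesis using P(1) by (auto simp: semigroup_zero_def)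
  qed
  moreover have "left_mean_ergodic S" if "semigroup_zero (K_co S) Q" for Q
    unfolding left_mean_ergodic_def
    by (intro allI impI exI) (rule left_ergodic_net_tendsto_zero[OF assms(1) K that])
  ultimately have iff: "left_mean_ergodic S \<longleftrightarrow> (\<exists>Q. semigroup_zero (K_co S) Q)" by metis
  have lim: "((\<lambda>\<alpha>. T \<alpha> x) \<longlongrightarrow> Q x) (net_filter A r)"
    if "semigroup_zero (K_co S) Q" "left_ergodic_net S A r T" for Q T x r and A :: "'i set"
    using left_ergodic_net_tendsto_zero[OF assms(1) K that] .
  show ?thesis by (intro conjI allI impI iff lim)
qed

end
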